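(* Let $q$ be an odd prime power. The set $$S = \{\, a \in \mathbb{F}_q: 2a+2 \text{ and } 2a-2 \text{ are squares in } \mathbb{F}_q\,\}$$ is preserved by Chebyshev polynomials; that is, for every $k\ge 0$, $s \in S$ implies $C_k(s) \in S$.
   Context: $\mathbb{F}_q$ is the field with $q$ elements; $0$ counts as a square. $C_k(x)\in\mathbb{Z}[x]$ is the $k$th Chebyshev polynomial of the first kind, determined by $C_k(\cos\theta)=\cos(k\theta)$ (e.g. $C_1(x)=x$, $C_2(x)=2x^2-1$, $C_3(x)=4x^3-3x$). Equivalently $C_k(x)=\tfrac12 D_k(2x)$, where $D_0(x)=2$, $D_1(x)=x$, $D_{k+2}(x)=xD_{k+1}(x)-D_k(x)$. It is evaluated on $\mathbb{F}_q$ by reducing its integer coefficients. *)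

theory Defs
  imports
    Complex_Main
    "HOL-Library.Cardinality"
    "HOL-Computational_Algebra.Computational_Algebra"
    "HOL-Computational_Algebra.Nth_Powers"
    "HOL-Number_Theory.Prime_Powers"
begin

definition is_chebyshev :: "nat \<Rightarrow> int poly \<Rightarrow> bool" where
  "is_chebyshev k p \<longleftrightarrow> (\<forall>\<theta>::real. poly (map_poly of_int p) (cos \<theta>) = cos (of_nat k * \<theta>))"

definition chebyshev :: "nat \<Rightarrow> int poly" where
  "chebyshev k = (THE p. is_chebyshev k p)"

(* Evaluation of an integer polynomial in an arbitrary commutative ring, the coefficients being
   mapped along the canonical homomorphism from the integers. *)
definition poly_of_int :: "int poly \<Rightarrow> 'a :: comm_ring_1 \<Rightarrow> 'a" where
  "poly_of_int p x = poly (map_poly of_int p) x"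

(* is_square from Nth_Powers allows the root 0, so 0 counts as a square. *)
definition cheb_set :: "'a :: finite_field set" where
  "cheb_set = {a. is_square (2 * a + 2) \<and> is_square (2 * a - 2)}"


(* The description in the definition of chebyshev determines a unique integer polynomial. *)

lemma is_chebyshev_unique:
  assumes "is_chebyshev k p" and "is_chebyshev k q"
  shows "p = q"
proof -
  let ?P = "map_poly of_int p :: real poly" and ?Q = "map_poly of_int q :: real poly"
  have "poly (?P - ?Q) x = 0" if "x \<in> {-1..1}" for x :: real
  proof -
    have "poly ?P (cos (arccos x)) = poly ?Q (cos (arccos x))"
      using assms unfolding is_chebyshev_def by simp
    with that show ?thesis by simp
  qed
  then have "{-1..1} \<subseteq> {x. poly (?P - ?Q) x = 0}" by blast
  moreover have "infinite {-1..1::real}" by (simp add: infinite_Icc)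
  ultimately have "infinite {x. poly (?P - ?Q) x = 0}" using infinite_super by blast
  then have "?P - ?Q = 0" using poly_roots_finite by blast
  then have "coeff ?P n = coeff ?Q n" for n by simp
  then show ?thesis by (intro poly_eqI) (simp add: coeff_map_poly)
qed

lemma poly_of_int_diff: "poly_of_int (p - q) x = poly_of_int p x - poly_of_int q x"
proof -
  have "map_poly of_int (p - q) = map_poly of_int p - (map_poly of_int q :: 'a poly)"
    by (intro poly_eqI) (simp add: coeff_map_poly)
  then show ?thesis by (simp add: poly_of_int_def)
qed

lemma poly_of_int_linear: "poly_of_int ([:0, c:] * p) x = of_int c * x * poly_of_int p x"
proof -
  have "map_poly of_int ([:0, c:] * p) = [:0, of_int c:] * (map_poly of_int p :: 'a poly)"
    by (intro poly_eqI) (simp add: coeff_map_poly coeff_pCons split: nat.split)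
  then show ?thesis by (simp add: poly_of_int_def mult_ac)
qed

lemma is_chebyshev_0: "is_chebyshev 0 1"
  and is_chebyshev_1: "is_chebyshev 1 [:0, 1:]"
  by (simp_all add: is_chebyshev_def map_poly_pCons)

lemma is_chebyshev_step:
  assumes "is_chebyshev k p" and "is_chebyshev (k + 1) q"
  shows "is_chebyshev (k + 2) ([:0, 2:] * q - p)"
  unfolding is_chebyshev_def poly_of_int_def [symmetric]
proof
  fix \<theta> :: real
  have "cos (of_nat (k + 2) * \<theta>) + cos (of_nat k * \<theta>) = 2 * cos \<theta> * cos (of_nat (k + 1) * \<theta>)"
    using cos_add [of "of_nat (k + 1) * \<theta>" \<theta>] cos_diff [of "of_nat (k + 1) * \<theta>" \<theta>]
    by (simp add: algebra_simps)
  moreover have "poly_of_int p (cos \<theta>) = cos (of_nat k * \<theta>)"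
    and "poly_of_int q (cos \<theta>) = cos (of_nat (k + 1) * \<theta>)"
    using assms by (simp_all add: is_chebyshev_def poly_of_int_def)
  ultimately show "poly_of_int ([:0, 2:] * q - p) (cos \<theta>) = cos (of_nat (k + 2) * \<theta>)"
    unfolding poly_of_int_diff poly_of_int_linear by simp
qed

lemma is_chebyshev_exists: "(\<exists>p. is_chebyshev k p) \<and> (\<exists>p. is_chebyshev (k + 1) p)"
proof (induction k)
  case 0
  show ?case using is_chebyshev_0 is_chebyshev_1 by auto
next
  case (Suc k)
  then obtain p q where "is_chebyshev k p" and "is_chebyshev (k + 1) q" by blast
  from is_chebyshev_step [OF this] Suc show ?case by auto
qed

lemma is_chebyshev_chebyshev: "is_chebyshev k (chebyshev k)"
  unfolding chebyshev_def
  by (rule theI') (use is_chebyshev_exists is_chebyshev_unique in blast)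

lemma chebyshev_eqI: "is_chebyshev k p \<Longrightarrow> chebyshev k = p"
  using is_chebyshev_chebyshev is_chebyshev_unique by blast

lemma chebyshev_0: "chebyshev 0 = 1"
  and chebyshev_1: "chebyshev 1 = [:0, 1:]"
  and chebyshev_rec: "chebyshev (k + 2) = [:0, 2:] * chebyshev (k + 1) - chebyshev k"
  by (rule chebyshev_eqI, rule is_chebyshev_0 is_chebyshev_1
        is_chebyshev_step [OF is_chebyshev_chebyshev is_chebyshev_chebyshev])+


fun dickson :: "nat \<Rightarrow> int poly" where
  "dickson 0 = [:2:]"
| "dickson (Suc 0) = [:0, 1:]"
| "dickson (Suc (Suc k)) = [:0, 1:] * dickson (Suc k) - dickson k"

lemma chebyshev_dickson: "smult 2 (chebyshev k) = pcompose (dickson k) [:0, 2:]"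
proof (induction k rule: dickson.induct)
  case 1
  show ?case by (simp add: chebyshev_0)
next
  case 2
  show ?case using chebyshev_1 by (simp add: pcompose_pCons)
next
  case (3 k)
  have "smult 2 (chebyshev (Suc (Suc k)))
      = [:0, 2:] * smult 2 (chebyshev (Suc k)) - smult 2 (chebyshev k)"
    using chebyshev_rec [of k] by (simp add: smult_diff_right)
  also have "\<dots> = pcompose (dickson (Suc (Suc k))) [:0, 2:]"
    unfolding 3 dickson.simps pcompose_diff pcompose_mult by (simp add: pcompose_pCons)
  finally show ?case .
qed

end

theory Submission
  imports Defs "HOL-Number_Theory.Residues"
begin

text \<open>
  Chebyshev polynomials satisfy \<open>2 C\<^sub>k((x + 1/x) / 2) = x\<^sup>k + 1/x\<^sup>k\<close>
  (\<open>two_chebyshev_eq_power_sum\<close>). The element \<open>s\<close> lies in the set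
  exactly when \<open>2 s = a\<^sup>2 + b\<^sup>2\<close> for some \<open>a\<close> and \<open>b\<close> of the field with \<open>a b = 1\<close>: in this case
  \<open>2 s + 2 = (a + b)\<^sup>2\<close> and \<open>2 s - 2 = (a - b)\<^sup>2\<close>, and conversely \<open>a\<close> and \<open>b\<close> are the half sum and
  the half difference of square roots of \<open>2 s + 2\<close> and \<open>2 s - 2\<close>
  (\<open>cheb_set_iff_sum_of_reciprocal_squares\<close>). Taking \<open>x = a\<^sup>2\<close> turns the
  application of \<open>C\<^sub>k\<close> into the replacement of \<open>a\<close> and \<open>b\<close> by \<open>a\<^sup>k\<close> and \<open>b\<^sup>k\<close>, whose product is again
  \<open>1\<close>.
\<close>

text \<open>
  This is \<open>cos (k \<theta>) = (e\<^bsup>ik\<theta>\<^esup> + e\<^bsup>-ik\<theta>\<^esup>) / 2\<close> without denominators: both sides satisfy the same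
  second-order recurrence with the same two initial values, so the identity holds in every commutative ring.
\<close>

lemma two_chebyshev_eq_power_sum:
  fixes a b x :: "'a :: comm_ring_1"
  assumes "a * b = 1" and "2 * x = a + b"
  shows "2 * poly_of_int (chebyshev k) x = a ^ k + b ^ k"
proof (induction k rule: dickson.induct)
  case 1
  show ?case by (simp add: chebyshev_0 poly_of_int_def)
next
  case 2
  show ?case using assms(2) chebyshev_1 by (simp add: poly_of_int_def map_poly_pCons)
next
  case (3 k)
  have rec: "chebyshev (Suc (Suc k)) = [:0, 2:] * chebyshev (Suc k) - chebyshev k"
    using chebyshev_rec [of k] by simp
  have "2 * poly_of_int (chebyshev (Suc (Suc k))) x
      = 2 * x * (2 * poly_of_int (chebyshev (Suc k)) x) - 2 * poly_of_int (chebyshev k) x"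
    unfolding rec poly_of_int_diff poly_of_int_linear by (simp add: algebra_simps)
  also have "\<dots> = (a + b) * (a ^ Suc k + b ^ Suc k) - (a ^ k + b ^ k)"
    by (simp only: 3 assms(2))
  also have "\<dots> = a ^ Suc (Suc k) + b ^ Suc (Suc k) + (a * b - 1) * (a ^ k + b ^ k)"
    by (simp add: algebra_simps)
  finally show ?case using assms(1) by simp
qed

lemma two_neq_zero_if_odd_card:
  assumes "odd CARD('a :: finite_field)"
  shows "(2 :: 'a) \<noteq> 0"
proof
  assume "(2 :: 'a) = 0"
  have "CHAR('a) dvd CARD('a)" by (rule CHAR_dvd_CARD)
  moreover have "CHAR('a) dvd 2"
    using \<open>(2 :: 'a) = 0\<close> of_nat_eq_0_iff_char_dvd [of 2, where 'a = 'a] by simp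
  then have "CHAR('a) = 2"
    using CHAR_not_1 [where 'a = 'a] two_is_prime_nat prime_nat_iff by auto
  ultimately show False using assms by simp
qed

text \<open>
  For roots \<open>u\<^sup>2 = 2 s + 2\<close> and \<open>v\<^sup>2 = 2 s - 2\<close>, the sum of the squares is \<open>4 s\<close> and the difference
  is the constant \<open>4 = (u + v) (u - v)\<close>, so the halves of the two factors are mutually inverse.
\<close>

lemma cheb_set_iff_sum_of_reciprocal_squares:
  fixes s :: "'a :: finite_field"
  assumes "(2 :: 'a) \<noteq> 0"
  shows "s \<in> cheb_set \<longleftrightarrow> (\<exists>a b. a * b = 1 \<and> 2 * s = a\<^sup>2 + b\<^sup>2)"
proof
  assume "s \<in> cheb_set"
  then obtain u v where u: "2 * s + 2 = u\<^sup>2" and v: "2 * s - 2 = v\<^sup>2"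
    by (auto simp: cheb_set_def is_nth_power_def)
  define a b where "a = (u + v) / 2" and "b = u - a"
  have "2 * a = u + v"
    using assms by (simp add: a_def)
  then have "a + b = u" and "a - b = v"
    by (simp_all add: b_def algebra_simps mult_2)
  have "2 * 2 * (a * b) = (a + b)\<^sup>2 - (a - b)\<^sup>2"
    by (simp add: power2_eq_square algebra_simps)
  also have "\<dots> = 2 * 2 * 1"
    by (simp add: \<open>a + b = u\<close> \<open>a - b = v\<close> flip: u v)
  finally have "a * b = 1"
    using assms by (metis mult_left_cancel no_zero_divisors)
  have "2 * (a\<^sup>2 + b\<^sup>2) = (a + b)\<^sup>2 + (a - b)\<^sup>2"
    by (simp add: power2_eq_square algebra_simps)
  also have "\<dots> = 2 * (2 * s)"
    by (simp add: \<open>a + b = u\<close> \<open>a - b = v\<close> flip: u v)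
  finally have "2 * s = a\<^sup>2 + b\<^sup>2"
    using assms by (metis mult_left_cancel)
  with \<open>a * b = 1\<close> show "\<exists>a b. a * b = 1 \<and> 2 * s = a\<^sup>2 + b\<^sup>2" by blast
next
  assume "\<exists>a b. a * b = 1 \<and> 2 * s = a\<^sup>2 + b\<^sup>2"
  then obtain a b where "a * b = 1" and s: "2 * s = a\<^sup>2 + b\<^sup>2" by blast
  then have "2 * s + 2 = (a + b)\<^sup>2" and "2 * s - 2 = (a - b)\<^sup>2"
    by (simp_all add: power2_sum power2_diff mult.assoc)
  then show "s \<in> cheb_set"
    unfolding cheb_set_def is_nth_power_def by blast
qed

theorem theorem4p1:
  fixes q k :: nat and s :: "'a :: finite_field"
  assumes "primepow q" and "odd q" and "CARD('a) = q"
    and "s \<in> cheb_set"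
  shows "poly_of_int (chebyshev k) s \<in> cheb_set"
proof -
  have two: "(2 :: 'a) \<noteq> 0"
    using assms(2,3) by (intro two_neq_zero_if_odd_card) simp
  obtain a b where "a * b = 1" and "2 * s = a\<^sup>2 + b\<^sup>2"
    using assms(4) cheb_set_iff_sum_of_reciprocal_squares [OF two] by blast
  have "a\<^sup>2 * b\<^sup>2 = 1"
    using \<open>a * b = 1\<close> by (simp flip: power_mult_distrib)
  then have "2 * poly_of_int (chebyshev k) s = (a ^ k)\<^sup>2 + (b ^ k)\<^sup>2"
    using two_chebyshev_eq_power_sum [of "a\<^sup>2" "b\<^sup>2" s k] \<open>2 * s = a\<^sup>2 + b\<^sup>2\<close>
    by (simp add: mult.commute flip: power_mult)
  moreover have "a ^ k * b ^ k = 1"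
    using \<open>a * b = 1\<close> by (simp flip: power_mult_distrib)
  ultimately show ?thesis
    using cheb_set_iff_sum_of_reciprocal_squares [OF two] by blast
qed

end
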